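(* Let $X$ be a nonempty set and $Y$ a nonempty subset of $X$. The semigroup $\overline{\Omega}(X,Y)$ is regular if and only if $Y$ is finite.
   Context: $T(X)$ is the semigroup of all maps $X\to X$ under composition; maps are written on the right and composed from left to right, so $x(fg)=(xf)g$, and $Yf=\{yf\colon y\in Y\}$. Let $\overline{\Omega}(X,Y)=\{f\in T(X)\colon Yf=Y\}$, a subsemigroup of $T(X)$. A semigroup $S$ is regular if for every $a\in S$ there exists $b\in S$ with $aba=a$. *)

theory Defs
  imports "HOL-Algebra.Group"
begin

text \<open>
  Maps \<open>X \<rightarrow> X\<close> are extensional functions on the carrier set \<open>X\<close>. Since maps
  are written on the right and composed from left to right, the product \<open>f g\<close> is \<open>g\<close> after \<open>f\<close>.
\<close>

definition full_transf :: "'a set \<Rightarrow> ('a \<Rightarrow> 'a) monoid" where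
  "full_transf X = \<lparr>carrier = X \<rightarrow>\<^sub>E X, mult = (\<lambda>f g. compose X g f), one = (\<lambda>x\<in>X. x)\<rparr>"

definition Omega_bar_set :: "'a set \<Rightarrow> 'a set \<Rightarrow> ('a \<Rightarrow> 'a) set" where
  "Omega_bar_set X Y = {f \<in> carrier (full_transf X). f ` Y = Y}"

definition Omega_bar :: "'a set \<Rightarrow> 'a set \<Rightarrow> ('a \<Rightarrow> 'a) monoid" where
  "Omega_bar X Y = (full_transf X)\<lparr>carrier := Omega_bar_set X Y\<rparr>"

text \<open>
  Regularity concerns only the semigroup reduct: the unit field of the record plays no role.
\<close>

definition regular_semigroup :: "('a, 'b) monoid_scheme \<Rightarrow> bool" where
  "regular_semigroup S \<longleftrightarrow>
     (\<forall>a \<in> carrier S. \<exists>b \<in> carrier S. a \<otimes>\<^bsub>S\<^esub> b \<otimes>\<^bsub>S\<^esub> a = a)"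

lemma full_transf_mult_apply:
  "x \<in> X \<Longrightarrow> (f \<otimes>\<^bsub>full_transf X\<^esub> g) x = g (f x)"
  by (simp add: full_transf_def compose_def)

lemma monoid_full_transf: "monoid (full_transf X)"
  by (rule monoidI)
    (auto simp: full_transf_def compose_def PiE_iff extensional_def restrict_def fun_eq_iff)

lemma submonoid_Omega_bar:
  assumes "Y \<subseteq> X"
  shows "submonoid (Omega_bar_set X Y) (full_transf X)"
proof
  show "Omega_bar_set X Y \<subseteq> carrier (full_transf X)"
    by (auto simp: Omega_bar_set_def)
next
  fix f g assume f: "f \<in> Omega_bar_set X Y" and g: "g \<in> Omega_bar_set X Y"
  have "(f \<otimes>\<^bsub>full_transf X\<^esub> g) ` Y = g ` f ` Y"
    using assms full_transf_mult_apply[of _ X f g] unfolding image_image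
    by (intro image_cong) auto
  moreover have "f \<otimes>\<^bsub>full_transf X\<^esub> g \<in> carrier (full_transf X)"
    using f g by (auto intro: monoid.m_closed[OF monoid_full_transf] simp: Omega_bar_set_def)
  ultimately show "f \<otimes>\<^bsub>full_transf X\<^esub> g \<in> Omega_bar_set X Y"
    using f g by (simp add: Omega_bar_set_def)
next
  show "\<one>\<^bsub>full_transf X\<^esub> \<in> Omega_bar_set X Y"
    using assms by (auto simp: Omega_bar_set_def full_transf_def image_iff subset_iff)
qed

end

theory Submission
  imports Defs
begin

text \<open>
  Write \<open>\<Omega>\<close> for \<open>Omega_bar X Y\<close>. An element \<open>a\<close> of \<open>\<Omega>\<close> restricts to a surjection of \<open>Y\<close> onto
  itself, and it is regular exactly when this restriction is injective. Indeed \<open>a b a = a\<close> makes \<open>b\<close> a section of \<open>a\<close> over the range of \<open>a\<close>,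
  which contains \<open>Y\<close>; as \<open>b\<close> must also map \<open>Y\<close> onto \<open>Y\<close>, it takes up every point of \<open>Y\<close> as a chosen
  preimage, so that no point of \<open>Y\<close> has two preimages in \<open>Y\<close>. Conversely, if \<open>a\<close> is injective on
  \<open>Y\<close>, then a section of \<open>a\<close> that picks preimages in \<open>Y\<close> over \<open>Y\<close> maps \<open>Y\<close> onto \<open>Y\<close>
  (\<open>regular_element_iff_inj_on\<close>).

  Hence \<open>\<Omega>\<close> is regular if and only if every surjection of \<open>Y\<close> onto itself is injective. This
  says that \<open>Y\<close> is finite: an infinite set is in bijection with itself minus a point, and the inverse
  of such a bijection extends to a surjection that is not injective
  (\<open>infinite_imp_surj_not_inj\<close>).
\<close>

lemma mem_Omega_bar_iff:
  "f \<in> carrier (Omega_bar X Y) \<longleftrightarrow> f \<in> X \<rightarrow>\<^sub>E X \<and> f ` Y = Y"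
  by (simp add: Omega_bar_def Omega_bar_set_def full_transf_def)

lemma Omega_bar_regular_eq_iff:
  assumes "a \<in> X \<rightarrow>\<^sub>E X"
  shows "a \<otimes>\<^bsub>Omega_bar X Y\<^esub> b \<otimes>\<^bsub>Omega_bar X Y\<^esub> a = a \<longleftrightarrow> (\<forall>x\<in>X. a (b (a x)) = a x)"
proof -
  have "a \<otimes>\<^bsub>Omega_bar X Y\<^esub> b \<otimes>\<^bsub>Omega_bar X Y\<^esub> a = (\<lambda>x\<in>X. a (b (a x)))"
    using assms by (intro ext) (auto simp: Omega_bar_def full_transf_def compose_def)
  moreover have "(\<lambda>x\<in>X. a (b (a x))) = a \<longleftrightarrow> (\<forall>x\<in>X. a (b (a x)) = a x)"
    using assms by (auto simp: PiE_iff extensional_def restrict_def fun_eq_iff)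
  ultimately show ?thesis
    by simp
qed

text \<open>
  Only the restriction of \<open>a\<close> to \<open>Y\<close> can obstruct regularity: membership of \<open>b\<close> in \<open>\<Omega>\<close> only
  constrains \<open>b\<close> on \<open>Y\<close>, so over the remaining points any choice of preimages is good.
\<close>

lemma regular_element_iff_inj_on:
  assumes "Y \<subseteq> X" and a: "a \<in> carrier (Omega_bar X Y)"
  shows "(\<exists>b \<in> carrier (Omega_bar X Y). a \<otimes>\<^bsub>Omega_bar X Y\<^esub> b \<otimes>\<^bsub>Omega_bar X Y\<^esub> a = a)
    \<longleftrightarrow> inj_on a Y"
proof -
  have aX: "a \<in> X \<rightarrow>\<^sub>E X" and aY: "a ` Y = Y"
    using a by (auto simp: mem_Omega_bar_iff)
  note reg_iff = Omega_bar_regular_eq_iff[OF aX, where Y = Y]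
  show ?thesis
  proof
    assume "\<exists>b \<in> carrier (Omega_bar X Y).
      a \<otimes>\<^bsub>Omega_bar X Y\<^esub> b \<otimes>\<^bsub>Omega_bar X Y\<^esub> a = a"
    then obtain b where bY: "b ` Y = Y" and aba: "\<forall>x\<in>X. a (b (a x)) = a x"
      by (auto simp: mem_Omega_bar_iff reg_iff)
    have ab: "a (b y) = y" if "y \<in> Y" for y
    proof -
      from that aY obtain x where "x \<in> Y" "y = a x"
        by blast
      then show ?thesis
        using aba \<open>Y \<subseteq> X\<close> by blast
    qed
    \<comment> \<open>Since \<open>b\<close> maps \<open>Y\<close> onto \<open>Y\<close>, this right inverse of \<open>a\<close> on \<open>Y\<close> is also a left inverse.\<close>
    have "b (a y) = y" if "y \<in> Y" for y
    proof -
      from that bY obtain z where "z \<in> Y" "y = b z"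
        by blast
      then show ?thesis
        using ab by simp
    qed
    then show "inj_on a Y"
      by (rule inj_on_inverseI)
  next
    assume inj: "inj_on a Y"
    \<comment> \<open>Off the range of \<open>a\<close>, the map \<open>b\<close> may take any values in \<open>X\<close>; the identity is one choice.\<close>
    define b where "b = (\<lambda>z\<in>X. if z \<in> Y then inv_into Y a z
      else if z \<in> a ` X then inv_into X a z else z)"
    have b_on_Y: "b z = inv_into Y a z" if "z \<in> Y" for z
      using that \<open>Y \<subseteq> X\<close> by (auto simp: b_def)
    have "inv_into Y a z \<in> X" if "z \<in> Y" for z
      using that aY \<open>Y \<subseteq> X\<close> by (metis inv_into_into subsetD)
    then have "b \<in> X \<rightarrow>\<^sub>E X"
      by (simp add: b_def inv_into_into)
    moreover have "b ` Y = Y"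
    proof -
      have "b ` Y = inv_into Y a ` Y"
        using b_on_Y by (rule image_cong[OF refl])
      also have "\<dots> = Y"
        using inv_into_image_cancel[OF inj order_refl] aY by simp
      finally show ?thesis .
    qed
    moreover have "a (b (a x)) = a x" if "x \<in> X" for x
    proof -
      have "a x \<in> X"
        using that aX by auto
      then show ?thesis
        using that aY by (simp add: b_def f_inv_into_f)
    qed
    ultimately show "\<exists>b \<in> carrier (Omega_bar X Y).
      a \<otimes>\<^bsub>Omega_bar X Y\<^esub> b \<otimes>\<^bsub>Omega_bar X Y\<^esub> a = a"
      by (intro bexI[where x = b]) (simp_all add: mem_Omega_bar_iff reg_iff)
  qed
qed

lemma infinite_imp_surj_not_inj:
  assumes "infinite Y"
  obtains g where "g ` Y = Y" and "\<not> inj_on g Y"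
proof -
  from assms obtain p where p: "p \<in> Y"
    by fastforce
  obtain h where h: "bij_betw h Y (Y - {p})"
    using infinite_imp_bij_betw[OF assms] by blast
  \<comment> \<open>The inverse of \<open>h\<close> uses up all values in \<open>Y\<close> without \<open>p\<close>, so any value in \<open>Y\<close> will do at \<open>p\<close>.\<close>
  define g where "g z = (if z = p then p else inv_into Y h z)" for z
  have "g ` (Y - {p}) = inv_into Y h ` (Y - {p})"
    by (rule image_cong) (auto simp: g_def)
  also have "\<dots> = Y"
    using h by (intro bij_betw_imp_surj_on bij_betw_inv_into)
  finally have onto: "g ` (Y - {p}) = Y" .
  have "g p = p"
    by (simp add: g_def)
  have "g ` Y = Y"
  proof -
    have "g ` Y = insert (g p) (g ` (Y - {p}))"
      using p by blast
    then show ?thesis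
      using onto p \<open>g p = p\<close> by auto
  qed
  moreover have "\<not> inj_on g Y"
  proof
    assume "inj_on g Y"
    moreover from onto p obtain q where "q \<in> Y - {p}" "p = g q"
      by blast
    ultimately show False
      using p \<open>g p = p\<close> by (auto dest: inj_onD)
  qed
  ultimately show thesis
    by (rule that)
qed

theorem proposition3p3:
  fixes X Y :: "'a set"
  assumes "X \<noteq> {}" and "Y \<noteq> {}" and "Y \<subseteq> X"
  shows "regular_semigroup (Omega_bar X Y) \<longleftrightarrow> finite Y"
proof
  assume reg: "regular_semigroup (Omega_bar X Y)"
  show "finite Y"
  proof (rule ccontr)
    assume "infinite Y"
    then obtain g where g: "g ` Y = Y" "\<not> inj_on g Y"
      by (rule infinite_imp_surj_not_inj)
    define a where "a = (\<lambda>x\<in>X. if x \<in> Y then g x else x)"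
    have a_on_Y: "a y = g y" if "y \<in> Y" for y
      using that \<open>Y \<subseteq> X\<close> by (auto simp: a_def)
    have "g y \<in> X" if "y \<in> Y" for y
      using that g(1) \<open>Y \<subseteq> X\<close> by blast
    then have "a \<in> X \<rightarrow>\<^sub>E X"
      by (simp add: a_def)
    moreover have "a ` Y = Y"
      using g(1) a_on_Y by (simp cong: image_cong)
    ultimately have "a \<in> carrier (Omega_bar X Y)"
      by (simp add: mem_Omega_bar_iff)
    then have "inj_on a Y"
      using reg regular_element_iff_inj_on[OF \<open>Y \<subseteq> X\<close>] by (simp add: regular_semigroup_def)
    then show False
      using g(2) a_on_Y by (simp cong: inj_on_cong)
  qed
next
  assume "finite Y"
  then have "inj_on a Y" if "a \<in> carrier (Omega_bar X Y)" for a
    using that finite_surj_inj[of Y a] by (simp add: mem_Omega_bar_iff)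
  then show "regular_semigroup (Omega_bar X Y)"
    using regular_element_iff_inj_on[OF \<open>Y \<subseteq> X\<close>] by (simp add: regular_semigroup_def)
qed

end
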